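(* Let $n\ge3$, $r=\lceil n/2\rceil$, $P=2^r+2^{n-r+1}-3$, and let $g<Q$ be positive integers. If $\tilde D$ is any $g$-colored distribution of $QP$ pebbles on the vertices of the cycle $C_n$, then $\tilde D$ is $Q$-coverable.
   Context: A $g$-colored distribution is a placement of pebbles on the vertices of a graph in which each pebble is assigned one of $g$ colors. A color-respecting pebbling step removes two pebbles of the same color from a vertex and places one pebble of that color on an adjacent vertex. A colored distribution is $Q$-coverable if some sequence of color-respecting pebbling steps results in every vertex having at least $Q$ pebbles (of any colors). *)

theory Defs
  imports Complex_Main
begin

text \<open>A graph is given by its vertex set \<open>V\<close> and its set \<open>E\<close> of edges, each edge being a
  two-element set of vertices.\<close>

definition cycle_vertices :: "nat \<Rightarrow> nat set" where
  "cycle_vertices n = {..<n}"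

definition cycle_edges :: "nat \<Rightarrow> nat set set" where
  "cycle_edges n = {{i, (i + 1) mod n} | i. i < n}"

text \<open>\<open>D v c\<close> is the number of pebbles of color \<open>c\<close> on the vertex \<open>v\<close>; the \<open>g\<close> colors are
  \<open>0, \<dots>, g - 1\<close>.\<close>

definition colored_distribution :: "'v set \<Rightarrow> nat \<Rightarrow> ('v \<Rightarrow> nat \<Rightarrow> nat) \<Rightarrow> bool" where
  "colored_distribution V g D \<longleftrightarrow> (\<forall>v c. D v c \<noteq> 0 \<longrightarrow> v \<in> V \<and> c < g)"

definition pebbles_at :: "nat \<Rightarrow> ('v \<Rightarrow> nat \<Rightarrow> nat) \<Rightarrow> 'v \<Rightarrow> nat" where
  "pebbles_at g D v = (\<Sum>c<g. D v c)"

definition num_pebbles :: "'v set \<Rightarrow> nat \<Rightarrow> ('v \<Rightarrow> nat \<Rightarrow> nat) \<Rightarrow> nat" where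
  "num_pebbles V g D = (\<Sum>v\<in>V. pebbles_at g D v)"

inductive pebbling_step ::
    "'v set set \<Rightarrow> ('v \<Rightarrow> nat \<Rightarrow> nat) \<Rightarrow> ('v \<Rightarrow> nat \<Rightarrow> nat) \<Rightarrow> bool" for E where
  "u \<noteq> v \<Longrightarrow> {u, v} \<in> E \<Longrightarrow> 2 \<le> D u c \<Longrightarrow>
    pebbling_step E D
      (D(u := (D u)(c := D u c - 2), v := (D v)(c := D v c + 1)))"

definition coverable ::
    "'v set \<Rightarrow> 'v set set \<Rightarrow> nat \<Rightarrow> nat \<Rightarrow> ('v \<Rightarrow> nat \<Rightarrow> nat) \<Rightarrow> bool" where
  "coverable V E g Q D \<longleftrightarrow>
    (\<exists>D'. (pebbling_step E)\<^sup>*\<^sup>* D D' \<and> (\<forall>v\<in>V. Q \<le> pebbles_at g D' v))"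

end

theory Submission imports Defs begin

text \<open>
  A vertex with more than \<open>g\<close> pebbles has two of the same color, so colors do not matter as long as
  pebbles are taken only from vertices that keep at least \<open>Q > g\<close> of them.  With such steps a path
  on \<open>l\<close> vertices can be covered as soon as it carries \<open>Q * (2^l - 1)\<close> pebbles.

  For \<open>n = 2p + 1\<close>, consider the two arcs of \<open>p\<close> vertices on either side of a vertex \<open>v\<close>, and put
  \<open>K = Q * (2^p - 1)\<close>.  Exchanging pebbles between \<open>v\<close> and the arcs gives a cover unless exactly one
  of the arcs carries more than \<open>2K\<close> pebbles.  If this happened at every \<open>v\<close>, shifting by \<open>p\<close>
  would flip the heavy side, hence shifting by \<open>2p\<close>, that is by \<open>-1\<close>, would preserve it: the side
  would be constant, a contradiction.

  For \<open>n = 2r\<close>, cut the cycle into two halves.  Unless both can be covered separately, exactly one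
  half carries \<open>Q * (2^r - 1)\<close> pebbles.  Rotating the cut, the heavy half must change sides at some
  vertex \<open>v\<close>; this \<open>v\<close> then has enough pebbles to supply what both of its sides lack.
\<close>

section \<open>Safe steps on uncolored totals and their lift to colors\<close>

text \<open>The bound \<open>Q + 2\<close> leaves \<open>Q\<close> pebbles on \<open>u\<close>, so a
  safe step never uncovers a covered vertex.\<close>

inductive safe_step :: "'v set set \<Rightarrow> nat \<Rightarrow> ('v \<Rightarrow> nat) \<Rightarrow> ('v \<Rightarrow> nat) \<Rightarrow> bool" for E Q where
  "u \<noteq> v \<Longrightarrow> {u, v} \<in> E \<Longrightarrow> Q + 2 \<le> N u \<Longrightarrow> safe_step E Q N (N(u := N u - 2, v := N v + 1))"

lemma ex_repeated_color:
  assumes "g < pebbles_at g D u"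
  obtains c where "c < g" "2 \<le> D u c"
proof -
  have "\<exists>c<g. 2 \<le> D u c"
  proof (rule ccontr)
    assume "\<not> ?thesis"
    then have "(\<Sum>c<g. D u c) \<le> (\<Sum>c<g. 1)" by (intro sum_mono) force
    then show False using assms by (simp add: pebbles_at_def)
  qed
  then show thesis using that by blast
qed

lemma sum_fun_upd_lessThan:
  fixes f :: "nat \<Rightarrow> nat"
  assumes "c < g"
  shows "(\<Sum>i<g. (f(c := y)) i) + f c = (\<Sum>i<g. f i) + y"
proof -
  have "(\<Sum>i\<in>{..<g} - {c}. (f(c := y)) i) = (\<Sum>i\<in>{..<g} - {c}. f i)"
    by (intro sum.cong) auto
  then show ?thesis
    using assms sum.remove[of "{..<g}" c "f(c := y)"] sum.remove[of "{..<g}" c f] by simp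
qed

text \<open>The donor holds more than \<open>g\<close> pebbles, so some color occurs twice there;
  whichever is moved, the totals change in the same way. Having equality of totals in the conclusion
  lets single steps be chained.\<close>

lemma safe_step_lift:
  assumes "safe_step E Q (pebbles_at g D) N'" "g < Q"
  shows "\<exists>D'. pebbling_step E D D' \<and> pebbles_at g D' = N'"
  using assms(1)
proof cases
  case (1 u v)
  obtain c where c: "c < g" "2 \<le> D u c"
    using ex_repeated_color[of g D u] 1 assms(2) by auto
  let ?D' = "D(u := (D u)(c := D u c - 2), v := (D v)(c := D v c + 1))"
  have "pebbling_step E D ?D'" using 1 c by (intro pebbling_step.intros) auto
  moreover have "pebbles_at g ?D' = N'"
  proof
    fix x
    have "pebbles_at g ?D' u = pebbles_at g D u - 2"
      using sum_fun_upd_lessThan[OF c(1), of "D u" "D u c - 2"] c(2) 1(2)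
      by (simp add: pebbles_at_def del: fun_upd_apply) (simp add: fun_upd_apply)
    moreover have "pebbles_at g ?D' v = pebbles_at g D v + 1"
      using sum_fun_upd_lessThan[OF c(1), of "D v" "D v c + 1"]
      by (simp add: pebbles_at_def)
    moreover have "pebbles_at g ?D' x = pebbles_at g D x" if "x \<noteq> u" "x \<noteq> v"
      using that by (simp add: pebbles_at_def)
    ultimately show "pebbles_at g ?D' x = N' x" using 1(1,2) by auto
  qed
  ultimately show ?thesis by blast
qed

lemma safe_steps_lift:
  assumes "(safe_step E Q)\<^sup>*\<^sup>* (pebbles_at g D) N'" "g < Q"
  shows "\<exists>D'. (pebbling_step E)\<^sup>*\<^sup>* D D' \<and> pebbles_at g D' = N'"
  using assms(1)
proof (induction rule: rtranclp_induct)
  case base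
  then show ?case by blast
next
  case (step N N')
  then show ?case
    using safe_step_lift[OF _ assms(2)] by (metis rtranclp.rtrancl_into_rtrancl)
qed

lemma safe_steps_move:
  assumes "u \<noteq> v" "{u, v} \<in> E" "Q + 2 * k \<le> N u"
  shows "(safe_step E Q)\<^sup>*\<^sup>* N (N(u := N u - 2 * k, v := N v + k))"
  using assms(3)
proof (induction k)
  case 0
  then show ?case by simp
next
  case (Suc k)
  let ?M = "N(u := N u - 2 * k, v := N v + k)"
  have "safe_step E Q ?M (?M(u := ?M u - 2, v := ?M v + 1))"
    using assms Suc.prems by (intro safe_step.intros) auto
  moreover have "?M(u := ?M u - 2, v := ?M v + 1) = N(u := N u - 2 * Suc k, v := N v + Suc k)"
    using assms(1) by (auto simp: fun_eq_iff)
  ultimately have "safe_step E Q ?M (N(u := N u - 2 * Suc k, v := N v + Suc k))" by metis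
  moreover have "(safe_step E Q)\<^sup>*\<^sup>* N ?M" by (rule Suc.IH) (use Suc.prems in simp)
  ultimately show ?case by (rule rtranclp.rtrancl_into_rtrancl[rotated])
qed

section \<open>Covering a path\<close>

abbreviation path :: "'v set set \<Rightarrow> 'v list \<Rightarrow> bool" where
  "path E xs \<equiv> distinct xs \<and> successively (\<lambda>a b. {a, b} \<in> E) xs"

text \<open>The surplus \<open>2 * t\<close> at the head allows \<open>t\<close> pebbles to be passed on to a neighbour of the
  path; the threshold is the cost of supplying everything from the far end.\<close>

lemma path_cover:
  assumes "xs \<noteq> []" "path E xs"
    and "Q * (2 ^ length xs - 1) + t * 2 ^ length xs \<le> sum_list (map N xs)"
  shows "\<exists>N'. (safe_step E Q)\<^sup>*\<^sup>* N N' \<and> (\<forall>v. v \<notin> set xs \<longrightarrow> N' v = N v) \<and>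
    (\<forall>v\<in>set xs. Q \<le> N' v) \<and> Q + 2 * t \<le> N' (hd xs)"
  using assms
proof (induction xs arbitrary: N t)
  case Nil
  then show ?case by simp
next
  case (Cons x xs)
  show ?case
  proof (cases xs)
    case Nil
    then show ?thesis using Cons.prems by (intro exI[of _ N]) auto
  next
    case (Cons y ys)
    have xs: "xs \<noteq> []" "path E xs" "hd xs = y" "y \<in> set xs" and xy: "x \<noteq> y" "{x, y} \<in> E" "x \<notin> set xs"
      using Cons Cons.prems by auto
    define B :: nat where "B = 2 ^ length xs - 1"
    have B: "2 ^ length xs = B + 1" by (simp add: B_def)
    define \<rho> where "\<rho> = sum_list (map N xs)"
    have total: "Q * (2 * B) + Q + t * (2 * B) + 2 * t \<le> N x + \<rho>"
      using Cons.prems(3) B by (simp add: \<rho>_def algebra_simps)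
    show ?thesis
    proof (cases "Q + 2 * t \<le> N x")
      case True
      \<comment> \<open>All that \<open>x\<close> can spare beyond \<open>Q + 2 * t\<close> goes to
        \<open>y\<close>, at half value.\<close>
      define k where "k = (N x - Q - 2 * t) div 2"
      let ?M = "N(x := N x - 2 * k, y := N y + k)"
      have "Q + 2 * k \<le> N x" using True by (simp add: k_def)
      then have M: "(safe_step E Q)\<^sup>*\<^sup>* N ?M" using safe_steps_move xy by metis
      have "sum_list (map ?M xs) = \<rho> + k"
      proof -
        have "sum_list (map ?M ys) = sum_list (map N ys)"
          using Cons xs xy by (intro arg_cong[where f = sum_list] map_cong) auto
        then show ?thesis using Cons xy by (simp add: \<rho>_def)
      qed
      \<comment> \<open>Rounding in \<open>k\<close> wastes at most one pebble, so
        \<open>total\<close> gives \<open>2 * (Q * B) \<le> 2 * k + \<rho> + 1\<close>; by parity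
        the odd pebble does no harm.\<close>
      moreover have "Q * B \<le> \<rho> + k"
      proof -
        have "N x \<le> 2 * k + Q + 2 * t + 1" using True unfolding k_def by linarith
        then show ?thesis using total by (simp add: algebra_simps)
      qed
      ultimately have "Q * (2 ^ length xs - 1) + 0 * 2 ^ length xs \<le> sum_list (map ?M xs)"
        using B by (simp del: fun_upd_apply)
      from Cons.IH[OF xs(1,2) this] obtain N' where N': "(safe_step E Q)\<^sup>*\<^sup>* ?M N'"
        "\<forall>v. v \<notin> set xs \<longrightarrow> N' v = ?M v" "\<forall>v\<in>set xs. Q \<le> N' v"
        by blast
      have "Q + 2 * t \<le> N' x" using N'(2) xy True by (simp add: k_def)
      moreover have "(safe_step E Q)\<^sup>*\<^sup>* N N'" by (rule rtranclp_trans[OF M N'(1)])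
      ultimately show ?thesis using N' xs xy by (intro exI[of _ N']) auto
    next
      case False
      \<comment> \<open>The deficit of \<open>x\<close>, requested from the tail as a surplus
        \<open>2 * s\<close> at \<open>y\<close>. As \<open>s\<close> is at most
        \<open>Q + 2 * t\<close>, the tail meets the threshold for it.\<close>
      define s where "s = Q + 2 * t - N x"
      have "s * B \<le> (Q + 2 * t) * B" by (simp add: s_def)
      then have "Q * B + s * (B + 1) \<le> \<rho>"
        using total False by (simp add: s_def algebra_simps)
      then obtain M where M: "(safe_step E Q)\<^sup>*\<^sup>* N M"
        "\<forall>v. v \<notin> set xs \<longrightarrow> M v = N v" "\<forall>v\<in>set xs. Q \<le> M v" "Q + 2 * s \<le> M y"
        using Cons.IH[of s N] xs B by (auto simp: \<rho>_def)
      let ?N = "M(y := M y - 2 * s, x := M x + s)"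
      have "(safe_step E Q)\<^sup>*\<^sup>* M ?N"
        using safe_steps_move[of y x E Q s M] M xy by (simp add: insert_commute)
      then have N: "(safe_step E Q)\<^sup>*\<^sup>* N ?N" by (rule rtranclp_trans[OF M(1)])
      show ?thesis
        by (rule exI[of _ ?N], intro conjI, rule N) (use M xs xy False in \<open>auto simp: s_def\<close>)
    qed
  qed
qed

text \<open>The surplus at the head of \<open>xs\<close> is pushed on to its neighbour
  \<open>v\<close>. Vertices off the path keep their pebbles, so a second path ending at
  \<open>v\<close> can be treated afterwards.\<close>

lemma path_cover_inflow:
  assumes "xs \<noteq> []" "path E (v # xs)"
    and "Q * (2 ^ length xs - 1) + t * 2 ^ length xs \<le> sum_list (map N xs)"
  shows "\<exists>N'. (safe_step E Q)\<^sup>*\<^sup>* N N' \<and> (\<forall>w. w \<notin> set (v # xs) \<longrightarrow> N' w = N w) \<and>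
    (\<forall>w\<in>set xs. Q \<le> N' w) \<and> N' v = N v + t"
proof -
  obtain y ys where xs: "xs = y # ys" using assms(1) by (cases xs) auto
  obtain M where M: "(safe_step E Q)\<^sup>*\<^sup>* N M" "\<forall>w. w \<notin> set xs \<longrightarrow> M w = N w"
    "\<forall>w\<in>set xs. Q \<le> M w" "Q + 2 * t \<le> M y"
    using path_cover[of xs E Q t N] assms xs by auto
  let ?N = "M(y := M y - 2 * t, v := M v + t)"
  have "(safe_step E Q)\<^sup>*\<^sup>* M ?N"
    using safe_steps_move[of y v E Q t M] M assms xs by (auto simp: insert_commute)
  then have N: "(safe_step E Q)\<^sup>*\<^sup>* N ?N" by (rule rtranclp_trans[OF M(1)])
  show ?thesis
    by (rule exI[of _ ?N], intro conjI, rule N) (use M assms xs in auto)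
qed

text \<open>The reverse exchange: \<open>v\<close> pays \<open>2 * k\<close> to raise the total of
  \<open>xs\<close> by \<open>k\<close>. Since \<open>path_cover\<close> depends only on that total,
  it does not matter that all \<open>k\<close> arrive at the head.\<close>

lemma path_cover_outflow:
  assumes "xs \<noteq> []" "path E (v # xs)"
    and "Q * (2 ^ length xs - 1) \<le> sum_list (map N xs) + k" "Q + 2 * k \<le> N v"
  shows "\<exists>N'. (safe_step E Q)\<^sup>*\<^sup>* N N' \<and> (\<forall>w. w \<notin> set (v # xs) \<longrightarrow> N' w = N w) \<and>
    (\<forall>w\<in>set xs. Q \<le> N' w) \<and> N' v = N v - 2 * k"
proof -
  obtain y ys where xs: "xs = y # ys" using assms(1) by (cases xs) auto
  let ?M = "N(v := N v - 2 * k, y := N y + k)"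
  have M: "(safe_step E Q)\<^sup>*\<^sup>* N ?M"
    using safe_steps_move[of v y E Q k N] assms xs by auto
  have "sum_list (map ?M ys) = sum_list (map N ys)"
    using assms(2) xs by (intro arg_cong[where f = sum_list] map_cong) auto
  then have "Q * (2 ^ length xs - 1) + 0 * 2 ^ length xs \<le> sum_list (map ?M xs)"
    using assms(2,3) xs by (simp add: ac_simps)
  then obtain N' where "(safe_step E Q)\<^sup>*\<^sup>* ?M N'" "\<forall>w. w \<notin> set xs \<longrightarrow> N' w = ?M w"
    "\<forall>w\<in>set xs. Q \<le> N' w"
    using path_cover[of xs E Q 0 ?M] assms xs by auto
  moreover from this M have "(safe_step E Q)\<^sup>*\<^sup>* N N'" by (meson rtranclp_trans)
  ultimately show ?thesis using assms xs by (intro exI[of _ N']) auto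
qed

section \<open>Covering with two disjoint paths\<close>

definition safe_coverable :: "'v set \<Rightarrow> 'v set set \<Rightarrow> nat \<Rightarrow> ('v \<Rightarrow> nat) \<Rightarrow> bool" where
  "safe_coverable V E Q N \<longleftrightarrow> (\<exists>N'. (safe_step E Q)\<^sup>*\<^sup>* N N' \<and> (\<forall>v\<in>V. Q \<le> N' v))"

lemma two_paths_safe_coverable:
  assumes "xs \<noteq> []" "ys \<noteq> []" "path E xs" "path E ys" "set xs \<inter> set ys = {}"
    and "Q * (2 ^ length xs - 1) \<le> sum_list (map N xs)"
    and "Q * (2 ^ length ys - 1) \<le> sum_list (map N ys)"
  shows "safe_coverable (set xs \<union> set ys) E Q N"
proof -
  obtain M where M: "(safe_step E Q)\<^sup>*\<^sup>* N M" "\<forall>w. w \<notin> set xs \<longrightarrow> M w = N w"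
    "\<forall>w\<in>set xs. Q \<le> M w"
    using path_cover[of xs E Q 0 N] assms by auto
  have "sum_list (map M ys) = sum_list (map N ys)"
    using M(2) assms(5) by (intro arg_cong[where f = sum_list] map_cong) auto
  then obtain N' where "(safe_step E Q)\<^sup>*\<^sup>* M N'" "\<forall>w. w \<notin> set ys \<longrightarrow> N' w = M w"
    "\<forall>w\<in>set ys. Q \<le> N' w"
    using path_cover[of ys E Q 0 M] assms by auto
  moreover from this M(1) have "(safe_step E Q)\<^sup>*\<^sup>* N N'" by (meson rtranclp_trans)
  ultimately show ?thesis
    using M assms(5) unfolding safe_coverable_def by (intro exI[of _ N']) auto
qed

lemma inflow_safe_coverable:
  assumes "xs \<noteq> []" "ys \<noteq> []" "path E (v # xs)" "path E (v # ys)" "set xs \<inter> set ys = {}"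
    and "Q * (2 ^ length xs - 1) + s * 2 ^ length xs \<le> sum_list (map N xs)"
    and "Q * (2 ^ length ys - 1) + t * 2 ^ length ys \<le> sum_list (map N ys)"
    and "Q \<le> N v + s + t"
  shows "safe_coverable (insert v (set xs \<union> set ys)) E Q N"
proof -
  obtain M where M: "(safe_step E Q)\<^sup>*\<^sup>* N M" "\<forall>w. w \<notin> set (v # xs) \<longrightarrow> M w = N w"
    "\<forall>w\<in>set xs. Q \<le> M w" "M v = N v + s"
    using path_cover_inflow[of xs v E Q s N] assms by blast
  have "sum_list (map M ys) = sum_list (map N ys)"
    using M(2) assms(4,5) by (intro arg_cong[where f = sum_list] map_cong) auto
  then obtain N' where "(safe_step E Q)\<^sup>*\<^sup>* M N'" "\<forall>w. w \<notin> set (v # ys) \<longrightarrow> N' w = M w"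
    "\<forall>w\<in>set ys. Q \<le> N' w" "N' v = M v + t"
    using path_cover_inflow[of ys v E Q t M] assms by metis
  moreover from this M(1) have "(safe_step E Q)\<^sup>*\<^sup>* N N'" by (meson rtranclp_trans)
  ultimately show ?thesis
    using M assms(3-5,8) unfolding safe_coverable_def by (intro exI[of _ N']) auto
qed

lemma outflow_safe_coverable:
  assumes "xs \<noteq> []" "ys \<noteq> []" "path E (v # xs)" "path E (v # ys)" "set xs \<inter> set ys = {}"
    and "Q * (2 ^ length xs - 1) \<le> sum_list (map N xs) + k"
    and "Q * (2 ^ length ys - 1) \<le> sum_list (map N ys) + l"
    and "Q + 2 * k + 2 * l \<le> N v"
  shows "safe_coverable (insert v (set xs \<union> set ys)) E Q N"
proof -
  obtain M where M: "(safe_step E Q)\<^sup>*\<^sup>* N M" "\<forall>w. w \<notin> set (v # xs) \<longrightarrow> M w = N w"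
    "\<forall>w\<in>set xs. Q \<le> M w" "M v = N v - 2 * k"
    using path_cover_outflow[of xs v E Q N k] assms by auto
  have "sum_list (map M ys) = sum_list (map N ys)"
    using M(2) assms(4,5) by (intro arg_cong[where f = sum_list] map_cong) auto
  \<comment> \<open>After paying for the first arm, \<open>v\<close> still has the budget for the
    second.\<close>
  moreover have "Q + 2 * l \<le> M v" using M(4) assms(8) by simp
  ultimately obtain N' where "(safe_step E Q)\<^sup>*\<^sup>* M N'" "\<forall>w. w \<notin> set (v # ys) \<longrightarrow> N' w = M w"
    "\<forall>w\<in>set ys. Q \<le> N' w" "N' v = M v - 2 * l"
    using path_cover_outflow[of ys v E Q M l] assms by metis
  moreover from this M(1) have "(safe_step E Q)\<^sup>*\<^sup>* N N'" by (meson rtranclp_trans)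
  ultimately show ?thesis
    using M assms(3-5,8) unfolding safe_coverable_def by (intro exI[of _ N']) auto
qed

section \<open>Arcs of the cycle and their pebble totals\<close>

text \<open>The start \<open>a\<close> is any natural number and only the entries are reduced, so
  arcs concatenate and rotate with no case split at the wrap-around.\<close>

definition arc :: "nat \<Rightarrow> nat \<Rightarrow> nat \<Rightarrow> nat list" where
  "arc n a l = map (\<lambda>i. (a + i) mod n) [0..<l]"

lemma length_arc [simp]: "length (arc n a l) = l"
  by (simp add: arc_def)

lemma arc_eq_Nil_iff [simp]: "arc n a l = [] \<longleftrightarrow> l = 0"
  by (simp add: arc_def)

lemma arc_add: "arc n a (k + l) = arc n a k @ arc n (a + k) l"
  by (rule nth_equalityI) (auto simp: arc_def nth_append)

lemma arc_shift [simp]: "arc n (a + n) l = arc n a l"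
proof -
  have "(a + n + i) mod n = (a + i) mod n" for i
    using mod_add_self2[of "a + i" n] by (simp add: ac_simps)
  then show ?thesis by (simp add: arc_def)
qed

lemma arc_1: "arc n a (Suc 0) = [a mod n]"
  by (simp add: arc_def)

lemma distinct_arc:
  assumes "l \<le> n" shows "distinct (arc n a l)"
proof -
  have "i = j" if "(a + i) mod n = (a + j) mod n" "i < n" "j < n" for i j
  proof -
    \<comment> \<open>Over the integers \<open>a\<close> can be subtracted from both sides of the
      congruence.\<close>
    have "int (a + i) mod int n = int (a + j) mod int n"
      using that(1) by (metis of_nat_mod)
    then have "(int (a + i) - int a) mod int n = (int (a + j) - int a) mod int n"
      by (rule mod_diff_cong) simp
    then show ?thesis using that by simp
  qed
  then have "inj_on (\<lambda>i. (a + i) mod n) {0..<l}"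
    using assms by (intro inj_onI) (meson atLeastLessThan_iff less_le_trans)
  then show ?thesis by (simp add: arc_def distinct_map)
qed

lemma set_arc_full:
  assumes "0 < n" shows "set (arc n a n) = cycle_vertices n"
proof (rule card_subset_eq)
  show "set (arc n a n) \<subseteq> cycle_vertices n"
    using assms by (auto simp: arc_def cycle_vertices_def)
  show "card (set (arc n a n)) = card (cycle_vertices n)"
    using distinct_card[OF distinct_arc[of n n a]] by (simp add: cycle_vertices_def)
qed (simp add: cycle_vertices_def)

lemma path_arc:
  assumes "l \<le> n" shows "path (cycle_edges n) (arc n a l)"
proof -
  have "{(a + i) mod n, Suc (a + i) mod n} \<in> cycle_edges n" if "Suc i < l" for i
  proof -
    have "(a + i) mod n < n" using that assms by simp
    moreover have "Suc (a + i) mod n = ((a + i) mod n + 1) mod n" by (simp add: mod_Suc_eq)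
    ultimately show ?thesis
      unfolding cycle_edges_def by (intro CollectI exI[of _ "(a + i) mod n"] conjI) simp_all
  qed
  then have "successively (\<lambda>a b. {a, b} \<in> cycle_edges n) (arc n a l)"
    by (simp add: arc_def successively_conv_nth)
  then show ?thesis using distinct_arc[OF assms] by blast
qed

lemma path_rev: "path E (rev xs) = path E xs"
  by (simp add: insert_commute)

text \<open>Both arms must begin next to \<open>v\<close>. The second arc ends at the predecessor of
  \<open>v\<close>, hence its reversal.\<close>

lemma arc_around:
  assumes "n = Suc (p + q)"
  shows "path (cycle_edges n) ((v mod n) # arc n (v + 1) p)"
    and "path (cycle_edges n) ((v mod n) # rev (arc n (v + 1 + p) q))"
    and "set (arc n (v + 1) p) \<inter> set (arc n (v + 1 + p) q) = {}"
    and "insert (v mod n) (set (arc n (v + 1) p) \<union> set (arc n (v + 1 + p) q)) = cycle_vertices n"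
proof -
  have fwd: "(v mod n) # arc n (v + 1) p = arc n v (1 + p)"
    by (subst arc_add) (simp add: arc_1)
  then show "path (cycle_edges n) ((v mod n) # arc n (v + 1) p)"
    using path_arc[of "1 + p" n v] assms by simp
  have "rev ((v mod n) # rev (arc n (v + 1 + p) q)) = arc n (v + 1 + p) (q + 1)"
  proof -
    have "(v + 1 + p + q) mod n = v mod n" using assms mod_add_self2[of v n] by (simp add: ac_simps)
    then show ?thesis by (subst arc_add) (simp add: arc_1)
  qed
  then show "path (cycle_edges n) ((v mod n) # rev (arc n (v + 1 + p) q))"
    using path_arc[of "q + 1" n "v + 1 + p"] assms
      path_rev[of "(v mod n) # rev (arc n (v + 1 + p) q)" "cycle_edges n"] by simp
  have full: "arc n v n = (v mod n) # arc n (v + 1) p @ arc n (v + 1 + p) q"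
    using arc_add[of n v "1 + p" q] fwd assms by simp
  show "set (arc n (v + 1) p) \<inter> set (arc n (v + 1 + p) q) = {}"
    using distinct_arc[of n n v] unfolding full by simp
  show "insert (v mod n) (set (arc n (v + 1) p) \<union> set (arc n (v + 1 + p) q)) = cycle_vertices n"
    using set_arc_full[of n v] assms unfolding full by simp
qed

definition arc_sum :: "(nat \<Rightarrow> nat) \<Rightarrow> nat \<Rightarrow> nat \<Rightarrow> nat \<Rightarrow> nat" where
  "arc_sum N n a l = sum_list (map N (arc n a l))"

lemma arc_sum_add: "arc_sum N n a (k + l) = arc_sum N n a k + arc_sum N n (a + k) l"
  by (simp add: arc_sum_def arc_add)

lemma arc_sum_shift [simp]: "arc_sum N n (a + n) l = arc_sum N n a l"
  by (simp add: arc_sum_def)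

lemma arc_sum_full:
  assumes "0 < n" shows "arc_sum N n a n = (\<Sum>v\<in>cycle_vertices n. N v)"
  using sum_list_distinct_conv_sum_set[OF distinct_arc[of n n a], of N] set_arc_full[OF assms, of a]
  by (simp add: arc_sum_def)

lemma arc_sum_around:
  assumes "n = Suc (p + q)"
  shows "(\<Sum>w\<in>cycle_vertices n. N w) =
    N (v mod n) + arc_sum N n (v + 1) p + arc_sum N n (v + 1 + p) q"
proof -
  have "arc_sum N n v n = arc_sum N n v 1 + arc_sum N n (v + 1) p + arc_sum N n (v + 1 + p) q"
    using arc_sum_add[of N n v 1 "p + q"] arc_sum_add[of N n "v + 1" p q] assms by simp
  then show ?thesis using arc_sum_full[of n N v] assms by (simp add: arc_sum_def arc_1)
qed

section \<open>Covering the cycle by two arcs\<close>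

lemma cycle_inflow:
  assumes "n = Suc (p + q)" "0 < p" "0 < q"
    and "Q * (2 ^ p - 1) + s * 2 ^ p \<le> arc_sum N n (v + 1) p"
    and "Q * (2 ^ q - 1) + t * 2 ^ q \<le> arc_sum N n (v + 1 + p) q"
    and "Q \<le> N (v mod n) + s + t"
  shows "safe_coverable (cycle_vertices n) (cycle_edges n) Q N"
  using inflow_safe_coverable[of "arc n (v + 1) p" "rev (arc n (v + 1 + p) q)" "v mod n"
      "cycle_edges n" Q s N t] arc_around[OF assms(1), of v] assms
  by (simp add: arc_sum_def flip: rev_map)

lemma cycle_outflow:
  assumes "n = Suc (p + q)" "0 < p" "0 < q"
    and "Q * (2 ^ p - 1) \<le> arc_sum N n (v + 1) p + k"
    and "Q * (2 ^ q - 1) \<le> arc_sum N n (v + 1 + p) q + l"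
    and "Q + 2 * k + 2 * l \<le> N (v mod n)"
  shows "safe_coverable (cycle_vertices n) (cycle_edges n) Q N"
  using outflow_safe_coverable[of "arc n (v + 1) p" "rev (arc n (v + 1 + p) q)" "v mod n"
      "cycle_edges n" Q N k l] arc_around[OF assms(1), of v] assms
  by (simp add: arc_sum_def flip: rev_map)

lemma cycle_two_arcs:
  assumes "n = p + q" "0 < p" "0 < q"
    and "Q * (2 ^ p - 1) \<le> arc_sum N n v p"
    and "Q * (2 ^ q - 1) \<le> arc_sum N n (v + p) q"
  shows "safe_coverable (cycle_vertices n) (cycle_edges n) Q N"
proof -
  have full: "arc n v n = arc n v p @ arc n (v + p) q" using arc_add assms(1) by simp
  have "set (arc n v p) \<inter> set (arc n (v + p) q) = {}"
    using distinct_arc[of n n v] unfolding full by simp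
  moreover have "set (arc n v p) \<union> set (arc n (v + p) q) = cycle_vertices n"
    using set_arc_full[of n v] assms(1,2) unfolding full by simp
  ultimately show ?thesis
    using two_paths_safe_coverable[of "arc n v p" "arc n (v + p) q" "cycle_edges n" Q N]
      path_arc[of p n v] path_arc[of q n "v + p"] assms by (simp add: arc_sum_def)
qed

section \<open>Odd and even cycles\<close>

lemma odd_cycle_safe_coverable:
  assumes n: "n = 2 * p + 1" and "0 < p"
    and total: "(\<Sum>w\<in>cycle_vertices n. N w) = Q * (2 ^ (p + 2) - 3)"
  shows "safe_coverable (cycle_vertices n) (cycle_edges n) Q N"
proof (rule ccontr)
  assume nc: "\<not> ?thesis"
  define B :: nat where "B = 2 ^ p - 1"
  have B: "2 ^ p = B + 1" by (simp add: B_def)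
  define heavy where "heavy v \<longleftrightarrow> 2 * (Q * B) < arc_sum N n (v + 1) p" for v
  have "Q * (2 ^ (p + 2) - 3) = 4 * (Q * B) + Q" using B by (simp add: algebra_simps)
  then have sum: "N (v mod n) + arc_sum N n (v + 1) p + arc_sum N n (v + 1 + p) p = 4 * (Q * B) + Q" for v
    using arc_sum_around[of n p p N v] n total by simp
  have opp: "heavy v \<longleftrightarrow> \<not> heavy (v + p)" for v
  proof -
    let ?R = "arc_sum N n (v + 1) p" and ?L = "arc_sum N n (v + 1 + p) p"
    \<comment> \<open>The second arc at \<open>v\<close> is the first arc at \<open>v + p\<close>,
      so one predicate describes both sides.\<close>
    have hL: "heavy (v + p) \<longleftrightarrow> 2 * (Q * B) < ?L" by (simp add: heavy_def ac_simps)
    have "\<not> (2 * (Q * B) < ?R \<and> 2 * (Q * B) < ?L)"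
    proof
      assume h: "2 * (Q * B) < ?R \<and> 2 * (Q * B) < ?L"
      \<comment> \<open>The excesses are what the arcs deliver to \<open>v\<close>. Delivering
        \<open>a\<close> needs \<open>Q * B + a * (B + 1)\<close>, which is at most
        \<open>2 * (Q * B) + a\<close> because \<open>a \<le> Q\<close>; likewise for
        \<open>b\<close>.\<close>
      define a b where "a = ?R - 2 * (Q * B)" and "b = ?L - 2 * (Q * B)"
      have ab: "?R = 2 * (Q * B) + a" "?L = 2 * (Q * B) + b" using h by (auto simp: a_def b_def)
      then have "a + b \<le> Q" "Q \<le> N (v mod n) + a + b" using sum[of v] by linarith+
      moreover from this have "a * B \<le> Q * B" "b * B \<le> Q * B" by simp_all
      ultimately show False
        using nc cycle_inflow[of n p p Q a N v b] n \<open>0 < p\<close> B ab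
        by (simp add: algebra_simps)
    qed
    moreover have "\<not> (?R \<le> 2 * (Q * B) \<and> ?L \<le> 2 * (Q * B))"
    proof
      assume "?R \<le> 2 * (Q * B) \<and> ?L \<le> 2 * (Q * B)"
      \<comment> \<open>Each arc leaves to \<open>v\<close> a share \<open>2 * (Q * B)\<close> minus
        its total. This is at least twice its shortage, also when the truncated shortage is
        0.\<close>
      then have "Q + 2 * (Q * B - ?R) + 2 * (Q * B - ?L) \<le> N (v mod n)"
        using sum[of v] by linarith
      then have "safe_coverable (cycle_vertices n) (cycle_edges n) Q N"
        using n \<open>0 < p\<close> B by (intro cycle_outflow[of n p p Q N v "Q * B - ?R" "Q * B - ?L"]) auto
      then show False using nc by contradiction
    qed
    ultimately show ?thesis using hL by (auto simp: heavy_def)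
  qed
  have "heavy (v + 1) = heavy v" for v
  proof -
    have "heavy (v + 1) = heavy (v + 1 + p + p)" using opp by blast
    also have "v + 1 + p + p = v + n" using n by simp
    also have "heavy (v + n) = heavy v"
      using arc_sum_shift[of N n "v + 1" p] by (simp add: heavy_def)
    finally show ?thesis .
  qed
  then have "heavy v = heavy 0" for v by (induction v) auto
  then show False using opp by blast
qed

lemma even_cycle_safe_coverable:
  assumes n: "n = 2 * Suc q" and "0 < q"
    and total: "(\<Sum>w\<in>cycle_vertices n. N w) = Q * (3 * (2 ^ Suc q - 1))"
  shows "safe_coverable (cycle_vertices n) (cycle_edges n) Q N"
proof (rule ccontr)
  assume nc: "\<not> ?thesis"
  define r where "r = Suc q"
  have r: "n = r + r" "0 < r" "n = Suc (q + r)" "n = Suc (r + q)" using n by (auto simp: r_def)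
  define K where "K = Q * (2 ^ q - 1)"
  obtain B :: nat where B: "2 ^ q = B + 1" "0 < B"
    using that[of "2 ^ q - 1"] one_less_power[of "2::nat" q] \<open>0 < q\<close> by simp
  have H: "Q * (2 ^ r - 1) = 2 * K + Q" and KQ: "Q \<le> K"
    using B by (auto simp: r_def K_def algebra_simps)
  have tot: "(\<Sum>w\<in>cycle_vertices n. N w) = 6 * K + 3 * Q"
    using total H by (simp add: r_def algebra_simps)
  have halves: "arc_sum N n v r + arc_sum N n (v + r) r = 6 * K + 3 * Q" for v
    using arc_sum_add[of N n v r r] arc_sum_full[of n N v] r(1,2) tot by simp
  define heavy where "heavy v \<longleftrightarrow> 2 * K + Q \<le> arc_sum N n v r" for v
  \<comment> \<open>The total is three times the threshold \<open>2 * K + Q\<close>, so two light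
    halves are impossible; two heavy halves are covered separately.\<close>
  have opp: "heavy v \<longleftrightarrow> \<not> heavy (v + r)" for v
    using nc cycle_two_arcs[of n r r Q N v] r H halves[of v] by (auto simp: heavy_def)
  have "\<exists>v. heavy v \<and> \<not> heavy (v + 1)"
  proof (rule ccontr)
    assume "\<not> ?thesis"
    then have "heavy v \<Longrightarrow> heavy (v + k)" for v k by (induction k) auto
    then show False using opp by blast
  qed
  then obtain v where v: "heavy v" "\<not> heavy (v + 1)" by blast
  \<comment> \<open>Here \<open>z\<close> counts the pebbles on the vertex opposite
    \<open>v\<close>; \<open>R\<close> and \<open>L\<close> are the totals strictly between the two
    on either side.\<close>
  define R z L where "R = arc_sum N n (v + 1) q" and "z = N ((v + r) mod n)"
    and "L = arc_sum N n (v + 1 + r) q"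
  have Rz: "arc_sum N n (v + 1) r = R + z"
    using arc_sum_add[of N n "v + 1" q 1] by (simp add: R_def z_def r_def arc_sum_def arc_1)
  have zL: "arc_sum N n (v + r) r = z + L"
    using arc_sum_add[of N n "v + r" 1 q] by (simp add: L_def z_def r_def arc_sum_def arc_1)
  have zL': "arc_sum N n (v + 1 + q) r = z + L"
    using zL by (simp add: r_def)
  have sum: "N (v mod n) + R + z + L = 6 * K + 3 * Q"
    using arc_sum_around[OF r(4), of N v] Rz tot by (simp add: L_def)
  have light: "R + z < 2 * K + Q" "z + L < 2 * K + Q"
    using v opp[of v] Rz zL by (auto simp: heavy_def)
  \<comment> \<open>The opposite vertex may be joined to either arm. If \<open>v\<close> cannot
    supply both arms, the first choice forces \<open>2 * K + R + z < L\<close> and the second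
    \<open>2 * K + L + z < R\<close>, which exclude each other.\<close>
  have short_left: "\<not> (2 * K + Q \<le> R + z + k \<and> K \<le> L + l \<and> Q + 2 * k + 2 * l \<le> N (v mod n))" for k l
    using nc cycle_outflow[OF r(4,2) \<open>0 < q\<close>, of Q N v k l] Rz H by (auto simp: L_def K_def)
  have short_right: "\<not> (K \<le> R + k \<and> 2 * K + Q \<le> z + L + l \<and> Q + 2 * k + 2 * l \<le> N (v mod n))" for k l
    using nc cycle_outflow[OF r(3) \<open>0 < q\<close> r(2), of Q N v k l] zL' H by (auto simp: R_def K_def)
  show False
    using short_left[of "2 * K + Q - (R + z)" "K - L"] short_right[of "K - R" "2 * K + Q - (z + L)"]
      light sum KQ by linarith
qed

theorem theorem3p4:
  fixes n r P g Q :: nat and D :: "nat \<Rightarrow> nat \<Rightarrow> nat"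
  assumes "n \<ge> 3"
    and "r = nat \<lceil>real n / 2\<rceil>"
    and "P = 2 ^ r + 2 ^ (n - r + 1) - 3"
    and "0 < g" and "g < Q"
    and "colored_distribution (cycle_vertices n) g D"
    and "num_pebbles (cycle_vertices n) g D = Q * P"
  shows "coverable (cycle_vertices n) (cycle_edges n) g Q D"
proof -
  have total: "(\<Sum>w\<in>cycle_vertices n. pebbles_at g D w) = Q * P"
    using assms(7) by (simp add: num_pebbles_def)
  have "safe_coverable (cycle_vertices n) (cycle_edges n) Q (pebbles_at g D)"
  proof (cases "even n")
    case True
    then obtain m where m: "n = 2 * m" by blast
    then obtain q where q: "m = Suc q" "0 < q" using assms(1) by (cases m) auto
    have "r = m" using assms(2) m by simp
    \<comment> \<open>Here \<open>n - r + 1 = m + 1\<close>, so \<open>P\<close> is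
      \<open>2 ^ m + 2 ^ (m + 1) - 3\<close>.\<close>
    then have "P = 3 * (2 ^ Suc q - 1)" using assms(3) m q by simp
    then show ?thesis using even_cycle_safe_coverable m q total by simp
  next
    case False
    then obtain p where p: "n = 2 * p + 1" by (metis oddE)
    have "\<lceil>real n / 2\<rceil> = int p + 1" using p by (intro ceiling_unique) auto
    then have "r = p + 1" using assms(2) by simp
    \<comment> \<open>Both exponents in \<open>P\<close> equal \<open>p + 1\<close>.\<close>
    then have "P = 2 ^ (p + 2) - 3" using assms(3) p by simp
    then show ?thesis using odd_cycle_safe_coverable[of n p] p assms(1) total by simp
  qed
  then show ?thesis
    using safe_steps_lift[OF _ assms(5)] unfolding safe_coverable_def coverable_def by blast
qed

end
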